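(* Let $V=\{v_1,\dots,v_n\}$ and let $\Delta$ be a pure simplicial complex on $V$ of dimension $d$ with $d>1$. If $\Delta$ is a quasi $f$-simplicial complex, then $\Delta$ is connected.
   Context: A simplicial complex on $V$ is a collection $\Delta$ of subsets of $V$ containing every singleton $\{v\}$, $v\in V$, and closed under taking subsets; maximal faces are facets, $\dim F=|F|-1$, and $\Delta$ is pure if all facets have the same dimension. $\Delta$ is connected if for any two facets $F,F'$ there is a sequence of facets $F=F_0,F_1,\dots,F_r=F'$ with $F_i\cap F_{i+1}\neq\emptyset$ for $0\le i\le r-1$. Let $k$ be a field, $R=k[x_1,\dots,x_n]$, and $x_F=\prod_{v_i\in F}x_i$. The facet ideal of $\Delta$ is $I_{\mathcal F}(\Delta)=(x_F: F \text{ a facet of } \Delta)$. For a square-free monomial ideal $I\subseteq R$ with minimal monomial generating set $G(I)$: the facet complex $\delta_{\mathcal F}(I)$ is the simplicial complex whose facets are the sets $\{v_{i_1},\dots,v_{i_r}\}$ with $x_{i_1}\cdots x_{i_r}\in G(I)$; the non-face complex $\delta_{\mathcal N}(I)$ is $\{F\subseteq V: x_F\notin I\}$. The $f$-vector of a $d$-dimensional complex is $(f_0,\dots,f_d)$, $f_i$ the number of faces with $i+1$ elements. $I$ is a quasi $f$-ideal of type $(a_1,\dots,a_s)\in\mathbb Z^s$ if $f(\delta_{\mathcal N}(I))-f(\delta_{\mathcal F}(I))=(a_1,\dots,a_s)$, both $f$-vectors lying in $\mathbb Z^s$. $\Delta$ is a quasi $f$-simplicial complex (of type $(a_1,\dots,a_s)$)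 if $I_{\mathcal F}(\Delta)$ is a quasi $f$-ideal (of type $(a_1,\dots,a_s)$) in $R$. *)

theory Defs
  imports Complex_Main "HOL-Library.Poly_Mapping"
begin

section \<open>Simplicial complexes\<close>

text \<open>The vertex set \<open>{v\<^sub>1, \<dots>, v\<^sub>n}\<close> is a finite type \<open>'v\<close> (so \<open>n = CARD('v)\<close>, and \<open>V = UNIV\<close>),
  which also indexes the variables of the polynomial ring.\<close>

definition simplicial_complex_on :: "'v set \<Rightarrow> 'v set set \<Rightarrow> bool" where
  "simplicial_complex_on V \<Delta> \<longleftrightarrow>
     \<Delta> \<subseteq> Pow V \<and> (\<forall>v\<in>V. {v} \<in> \<Delta>) \<and> (\<forall>F\<in>\<Delta>. \<forall>G. G \<subseteq> F \<longrightarrow> G \<in> \<Delta>)"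

definition facets :: "'v set set \<Rightarrow> 'v set set" where
  "facets \<Delta> = {F \<in> \<Delta>. \<forall>G\<in>\<Delta>. F \<subseteq> G \<longrightarrow> F = G}"

definition face_dim :: "'v set \<Rightarrow> int" where
  "face_dim F = int (card F) - 1"

text \<open>Every face has dimension at least \<open>-1\<close>, so inserting \<open>-1\<close> affects only the complex
  without faces, for which \<open>Max\<close> would be unspecified.\<close>

definition complex_dim :: "'v set set \<Rightarrow> int" where
  "complex_dim \<Delta> = Max (insert (-1) (face_dim ` \<Delta>))"

definition pure_complex :: "'v set set \<Rightarrow> bool" where
  "pure_complex \<Delta> \<longleftrightarrow> (\<forall>F\<in>facets \<Delta>. \<forall>F'\<in>facets \<Delta>. face_dim F = face_dim F')"

definition connected_complex :: "'v set set \<Rightarrow> bool" where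
  "connected_complex \<Delta> \<longleftrightarrow>
     (\<forall>F\<in>facets \<Delta>. \<forall>F'\<in>facets \<Delta>. \<exists>(r::nat) S.
        S 0 = F \<and> S r = F' \<and> (\<forall>i\<le>r. S i \<in> facets \<Delta>) \<and> (\<forall>i<r. S i \<inter> S (Suc i) \<noteq> {}))"

text \<open>The list \<open>[f\<^sub>0, \<dots>, f\<^sub>d]\<close> with \<open>d = complex_dim \<Delta>\<close>; its length is \<open>d + 1\<close>.\<close>

definition f_vector :: "'v set set \<Rightarrow> int list" where
  "f_vector \<Delta> =
     map (\<lambda>i. int (card {F \<in> \<Delta>. card F = i + 1})) [0..<nat (complex_dim \<Delta> + 1)]"

section \<open>Square-free monomial ideals\<close>

text \<open>The polynomial ring \<open>k[x\<^sub>v : v \<in> 'v]\<close>: finitely supported functions from exponent vectors to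
  coefficients, with the convolution product of \<^theory>\<open>HOL-Library.Poly_Mapping\<close>.\<close>

type_synonym ('v, 'k) polys = "('v \<Rightarrow>\<^sub>0 nat) \<Rightarrow>\<^sub>0 'k"

definition xvar :: "'v \<Rightarrow> ('v, 'k::field) polys" where
  "xvar v = Poly_Mapping.single (Poly_Mapping.single v 1) 1"

definition xset :: "'v::finite set \<Rightarrow> ('v, 'k::field) polys" where
  "xset F = (\<Prod>v\<in>F. xvar v)"

definition monomials :: "('v, 'k::field) polys set" where
  "monomials = range (\<lambda>m. Poly_Mapping.single m 1)"

text \<open>The ideal generated by \<open>S\<close> is the submodule spanned by \<open>S\<close> in the ring, viewed as a module
  over itself.\<close>

lemma module_times: "module ((*) :: 'a \<Rightarrow> 'a \<Rightarrow> 'a::comm_ring_1)"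
  by unfold_locales (simp_all add: algebra_simps)

definition ideal_gen :: "'a::comm_ring_1 set \<Rightarrow> 'a set" where
  "ideal_gen S = module.span (*) S"

definition squarefree_monomial_ideal :: "('v::finite, 'k::field) polys set \<Rightarrow> bool" where
  "squarefree_monomial_ideal I \<longleftrightarrow> (\<exists>A. I = ideal_gen (xset ` A))"

definition is_min_monomial_gens ::
    "('v, 'k::field) polys set \<Rightarrow> ('v, 'k) polys set \<Rightarrow> bool" where
  "is_min_monomial_gens G I \<longleftrightarrow>
     G \<subseteq> monomials \<and> ideal_gen G = I \<and> (\<forall>H. H \<subset> G \<longrightarrow> ideal_gen H \<noteq> I)"

text \<open>A monomial ideal has exactly one such generating set, so the description is
  proper there; for any other \<open>I\<close> the value is unspecified.\<close>

definition min_gens :: "('v, 'k::field) polys set \<Rightarrow> ('v, 'k) polys set" where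
  "min_gens I = (THE G. is_min_monomial_gens G I)"

definition facet_ideal :: "'v::finite set set \<Rightarrow> ('v, 'k::field) polys set" where
  "facet_ideal \<Delta> = ideal_gen (xset ` facets \<Delta>)"

text \<open>The sets \<open>G\<close> with \<open>x\<^sub>G\<close> a minimal generator are pairwise incomparable, hence they
  are exactly the facets of the complex of all their subsets.\<close>

definition facet_complex :: "('v::finite, 'k::field) polys set \<Rightarrow> 'v set set" where
  "facet_complex I = {F. \<exists>G. xset G \<in> min_gens I \<and> F \<subseteq> G}"

definition nonface_complex :: "('v::finite, 'k::field) polys set \<Rightarrow> 'v set set" where
  "nonface_complex I = {F. xset F \<notin> I}"

section \<open>Quasi \<open>f\<close>-ideals\<close>

text \<open>The type \<open>a\<close> is a vector of length \<open>s\<close>. Both \<open>f\<close>-vectors are required to have this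
  same length: they are not padded with zeros.\<close>

definition quasi_f_ideal_of_type :: "('v::finite, 'k::field) polys set \<Rightarrow> int list \<Rightarrow> bool" where
  "quasi_f_ideal_of_type I a \<longleftrightarrow>
     squarefree_monomial_ideal I \<and>
     length (f_vector (nonface_complex I)) = length a \<and>
     length (f_vector (facet_complex I)) = length a \<and>
     map2 (-) (f_vector (nonface_complex I)) (f_vector (facet_complex I)) = a"

definition quasi_f_ideal :: "('v::finite, 'k::field) polys set \<Rightarrow> bool" where
  "quasi_f_ideal I \<longleftrightarrow> (\<exists>a. quasi_f_ideal_of_type I a)"

definition quasi_f_simplicial_complex ::
    "'k::field itself \<Rightarrow> 'v::finite set set \<Rightarrow> bool" where
  "quasi_f_simplicial_complex _ \<Delta> \<longleftrightarrow>
     quasi_f_ideal (facet_ideal \<Delta> :: ('v, 'k) polys set)"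

end

(* The minimal generators of the facet ideal of D are the x_F with F a facet, so the facet complex
   of that ideal has dimension d. Equality of the lengths of the two f-vectors then says that the
   non-face complex also has dimension d: every set of d + 2 vertices contains a facet. If F and F'
   are facets in different components, choose 2 vertices of F and d vertices of F'. A facet among
   these d + 2 vertices has d + 1 > 2 elements, so it meets both F and F' and joins the two
   components. *)

theory Submission
  imports Defs
begin

interpretation ring_module: module "(*) :: 'a \<Rightarrow> 'a \<Rightarrow> 'a::comm_ring_1"
  by (rule module_times)

section \<open>Membership in monomial ideals\<close>

abbreviation monom :: "('v \<Rightarrow>\<^sub>0 nat) \<Rightarrow> ('v, 'k::field) polys" where
  "monom m \<equiv> Poly_Mapping.single m 1"

text \<open>Divisibility of monomials, expressed on their exponent vectors.\<close>

definition adds :: "('v \<Rightarrow>\<^sub>0 nat) \<Rightarrow> ('v \<Rightarrow>\<^sub>0 nat) \<Rightarrow> bool" where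
  "adds a b \<longleftrightarrow> (\<exists>c. b = a + c)"

lemma adds_refl: "adds a a"
  unfolding adds_def by (metis add.right_neutral)

lemma adds_trans: "adds a b \<Longrightarrow> adds b c \<Longrightarrow> adds a c"
  unfolding adds_def by (metis add.assoc)

lemma adds_lookup_le: "adds a b \<Longrightarrow> Poly_Mapping.lookup a v \<le> Poly_Mapping.lookup b v"
  unfolding adds_def by (auto simp: lookup_add)

lemma adds_antisym: "adds a b \<Longrightarrow> adds b a \<Longrightarrow> a = b"
  by (intro poly_mapping_eqI) (simp add: adds_lookup_le antisym)

lemma monom_inject: "(monom a :: ('v, 'k::field) polys) = monom b \<longleftrightarrow> a = b"
  by (metis lookup_single_eq lookup_single_not_eq zero_neq_one)

lemma monom_in_ideal_gen_iff:
  fixes A :: "('v \<Rightarrow>\<^sub>0 nat) set"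
  shows "(monom m :: ('v, 'k::field) polys) \<in> ideal_gen (monom ` A) \<longleftrightarrow> (\<exists>a\<in>A. adds a m)"
proof
  \<comment> \<open>The polynomials whose monomials are all divisible by some generator form an
    ideal. It contains the generators, hence the ideal that they generate.\<close>
  let ?S = "{p :: ('v, 'k) polys. \<forall>m\<in>Poly_Mapping.keys p. \<exists>a\<in>A. adds a m}"
  have "ring_module.subspace ?S"
  proof (rule ring_module.subspaceI)
    fix x y assume "x \<in> ?S" "y \<in> ?S"
    then show "x + y \<in> ?S" using Poly_Mapping.keys_add[of x y] by blast
  next
    fix c x assume x: "x \<in> ?S"
    have "\<exists>a\<in>A. adds a k" if k: "k \<in> Poly_Mapping.keys (c * x)" for k
    proof -
      obtain i j where "k = i + j" "j \<in> Poly_Mapping.keys x"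
        using k keys_mult[of c x] by blast
      with x obtain a where "a \<in> A" "adds a j" by blast
      moreover have "adds j k" unfolding adds_def \<open>k = i + j\<close> by (metis add.commute)
      ultimately show ?thesis using adds_trans by blast
    qed
    then show "c * x \<in> ?S" by blast
  qed simp
  moreover have "monom ` A \<subseteq> ?S" by (auto intro: bexI adds_refl)
  ultimately have "ideal_gen (monom ` A) \<subseteq> ?S"
    unfolding ideal_gen_def by (rule ring_module.span_minimal[rotated])
  moreover assume "(monom m :: ('v, 'k) polys) \<in> ideal_gen (monom ` A)"
  ultimately show "\<exists>a\<in>A. adds a m" by auto
next
  assume "\<exists>a\<in>A. adds a m"
  then obtain a c where "a \<in> A" "m = a + c" unfolding adds_def by blast
  then have "(monom m :: ('v, 'k) polys) = monom c * monom a"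
    by (simp add: mult_single add.commute)
  with \<open>a \<in> A\<close> show "(monom m :: ('v, 'k) polys) \<in> ideal_gen (monom ` A)"
    unfolding ideal_gen_def
    by (simp add: ring_module.span_base ring_module.span_scale)
qed

lemma ideal_gen_monom_subset_iff:
  "(ideal_gen (monom ` A) :: ('v, 'k::field) polys set) \<subseteq> ideal_gen (monom ` B) \<longleftrightarrow>
     (\<forall>a\<in>A. \<exists>b\<in>B. adds b a)"
proof -
  have "ideal_gen (monom ` A) \<subseteq> (ideal_gen (monom ` B) :: ('v, 'k) polys set) \<longleftrightarrow>
      monom ` A \<subseteq> (ideal_gen (monom ` B) :: ('v, 'k) polys set)"
    unfolding ideal_gen_def
    by (meson order_trans ring_module.span_minimal ring_module.span_superset
        ring_module.subspace_span)
  then show ?thesis by (simp add: image_subset_iff monom_in_ideal_gen_iff)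
qed

section \<open>Uniqueness of the minimal monomial generating set\<close>

lemma min_monomial_gens_antichain:
  assumes "is_min_monomial_gens (monom ` A :: ('v, 'k::field) polys set) I"
    and "a \<in> A" "b \<in> A" "adds a b"
  shows "a = b"
proof (rule ccontr)
  assume "a \<noteq> b"
  \<comment> \<open>The generator \<open>b\<close> is redundant: \<open>a\<close> divides it, and
    every other exponent divides itself.\<close>
  have "\<exists>c\<in>A - {b}. adds c x" if "x \<in> A" for x
    using that assms(2,4) \<open>a \<noteq> b\<close> adds_refl by blast
  then have "ideal_gen (monom ` (A - {b})) = (ideal_gen (monom ` A) :: ('v, 'k) polys set)"
    by (intro antisym) (auto simp: ideal_gen_monom_subset_iff intro: adds_refl)
  \<comment> \<open>Minimality concerns proper subsets of the image, so injectivity of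
    \<open>monom\<close> is what ensures that deleting \<open>b\<close> from \<open>A\<close> loses
    a generator.\<close>
  moreover have "(monom b :: ('v, 'k) polys) \<notin> monom ` (A - {b})"
    by (auto simp only: monom_inject)
  then have "monom ` (A - {b}) \<subset> (monom ` A :: ('v, 'k) polys set)" using \<open>b \<in> A\<close> by blast
  ultimately show False using assms(1) unfolding is_min_monomial_gens_def by metis
qed

text \<open>Each \<open>a\<close> in \<open>A\<close> has a divisor \<open>b\<close> in
  \<open>B\<close>, which in turn has a divisor \<open>a'\<close> in \<open>A\<close>. No exponent
  in \<open>A\<close> properly divides another, so \<open>a' = a\<close> and therefore
  \<open>b = a\<close>. Exchanging \<open>G\<close> and \<open>H\<close> gives equality, so the
  description in \<open>min_gens\<close> is well defined.\<close>

lemma min_monomial_gens_subset: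
  assumes "is_min_monomial_gens G I" "is_min_monomial_gens H I"
  shows "G \<subseteq> (H :: ('v, 'k::field) polys set)"
proof -
  obtain A B where A: "G = monom ` A" and B: "H = monom ` B"
    using assms unfolding is_min_monomial_gens_def monomials_def by (meson subset_imageE)
  have eq: "ideal_gen (monom ` A) = (ideal_gen (monom ` B) :: ('v, 'k) polys set)"
    using assms A B unfolding is_min_monomial_gens_def by simp
  have "a \<in> B" if a: "a \<in> A" for a
  proof -
    obtain b where b: "b \<in> B" "adds b a"
      using ideal_gen_monom_subset_iff[of A B, THEN iffD1, OF equalityD1[OF eq]] a by blast
    obtain a' where a': "a' \<in> A" "adds a' b"
      using ideal_gen_monom_subset_iff[of B A, THEN iffD1, OF equalityD2[OF eq]] b(1) by blast
    then have "a' = a"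
      using min_monomial_gens_antichain[of A I] assms(1) A a b(2) adds_trans by metis
    then show "a \<in> B" using b a'(2) adds_antisym by metis
  qed
  then show ?thesis unfolding A B by blast
qed

lemma min_gens_eqI:
  "is_min_monomial_gens G (I :: ('v, 'k::field) polys set) \<Longrightarrow> min_gens I = G"
  unfolding min_gens_def
  by (rule the_equality) (auto dest: min_monomial_gens_subset)

section \<open>Square-free monomials and their exponent vectors\<close>

definition indicator_exp :: "'v::finite set \<Rightarrow> 'v \<Rightarrow>\<^sub>0 nat" where
  "indicator_exp F = (\<Sum>v\<in>F. Poly_Mapping.single v 1)"

lemma lookup_indicator_exp: "Poly_Mapping.lookup (indicator_exp F) v = (if v \<in> F then 1 else 0)"
  unfolding indicator_exp_def
  by (simp add: lookup_sum lookup_single when_def)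

lemma adds_indicator_exp_iff: "adds (indicator_exp F) (indicator_exp G) \<longleftrightarrow> F \<subseteq> G"
proof
  assume "adds (indicator_exp F) (indicator_exp G)"
  from adds_lookup_le[OF this] have "v \<in> F \<Longrightarrow> v \<in> G" for v
    unfolding lookup_indicator_exp by (metis not_one_le_zero)
  then show "F \<subseteq> G" by blast
next
  assume "F \<subseteq> G"
  \<comment> \<open>The quotient of the two monomials belongs to the set
    \<open>G - F\<close>.\<close>
  then have "indicator_exp G = indicator_exp F + indicator_exp (G - F)"
    by (intro poly_mapping_eqI) (auto simp: lookup_add lookup_indicator_exp)
  then show "adds (indicator_exp F) (indicator_exp G)" unfolding adds_def by blast
qed

lemma xset_eq_monom: "(xset F :: ('v::finite, 'k::field) polys) = monom (indicator_exp F)"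
proof -
  have "(\<Prod>v\<in>F. xvar v :: ('v, 'k) polys) = monom (\<Sum>v\<in>F. Poly_Mapping.single v 1)"
    by (induction F rule: infinite_finite_induct)
      (simp_all add: xvar_def mult_single)
  then show ?thesis unfolding xset_def indicator_exp_def .
qed

lemma xset_image: "(xset ` A :: ('v::finite, 'k::field) polys set) = monom ` indicator_exp ` A"
  by (simp add: image_image xset_eq_monom)

lemma xset_in_ideal_gen_iff:
  "(xset F :: ('v::finite, 'k::field) polys) \<in> ideal_gen (xset ` A) \<longleftrightarrow> (\<exists>G\<in>A. G \<subseteq> F)"
  unfolding xset_image xset_eq_monom monom_in_ideal_gen_iff by (simp add: adds_indicator_exp_iff)

text \<open>Equal monomials lie in each other's principal ideals, which gives both inclusions
  between the sets.\<close>

lemma xset_inject: "(xset F :: ('v::finite, 'k::field) polys) = xset G \<longleftrightarrow> F = G"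
  using xset_in_ideal_gen_iff[where A = "{F}" and F = G and 'k = 'k]
    xset_in_ideal_gen_iff[where A = "{G}" and F = F and 'k = 'k]
    xset_in_ideal_gen_iff[where A = "{F}" and F = F and 'k = 'k]
    xset_in_ideal_gen_iff[where A = "{G}" and F = G and 'k = 'k]
  by auto

section \<open>The two complexes of a facet ideal\<close>

lemma min_gens_facet_ideal:
  fixes \<Delta> :: "'v::finite set set"
  shows "min_gens (facet_ideal \<Delta> :: ('v, 'k::field) polys set) = xset ` facets \<Delta>"
proof (rule min_gens_eqI)
  have "ideal_gen H \<noteq> facet_ideal \<Delta>"
    if H: "H \<subset> (xset ` facets \<Delta> :: ('v, 'k) polys set)" for H
  proof
    assume eq: "ideal_gen H = facet_ideal \<Delta>"
    obtain A where A: "A \<subseteq> facets \<Delta>" "H = xset ` A"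
      using H by (meson subset_imageE psubset_imp_subset)
    then obtain F where F: "F \<in> facets \<Delta>" "F \<notin> A" using H by blast
    \<comment> \<open>If the facet \<open>F\<close> could be omitted, a remaining generator would
      divide its monomial, and one facet would lie properly inside another.\<close>
    have "(xset F :: ('v, 'k) polys) \<in> ideal_gen (xset ` A)"
      using eq F(1) A(2) unfolding facet_ideal_def by (auto simp: xset_in_ideal_gen_iff)
    then obtain G where "G \<in> A" "G \<subseteq> F" by (auto simp: xset_in_ideal_gen_iff)
    then show False using A(1) F unfolding facets_def by blast
  qed
  then show "is_min_monomial_gens (xset ` facets \<Delta>) (facet_ideal \<Delta> :: ('v, 'k) polys set)"
    unfolding is_min_monomial_gens_def facet_ideal_def monomials_def
    by (auto simp: xset_eq_monom)
qed

lemma facet_complex_facet_ideal: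
  fixes \<Delta> :: "'v::finite set set"
  shows "facet_complex (facet_ideal \<Delta> :: ('v, 'k::field) polys set) = {F. \<exists>G\<in>facets \<Delta>. F \<subseteq> G}"
  unfolding facet_complex_def min_gens_facet_ideal by (auto simp: xset_inject)

lemma nonface_complex_facet_ideal:
  fixes \<Delta> :: "'v::finite set set"
  shows "nonface_complex (facet_ideal \<Delta> :: ('v, 'k::field) polys set) =
    {F. \<not> (\<exists>G\<in>facets \<Delta>. G \<subseteq> F)}"
  unfolding nonface_complex_def facet_ideal_def by (simp add: xset_in_ideal_gen_iff)

section \<open>Dimensions and lengths of f-vectors\<close>

lemma complex_dim_ge: "-1 \<le> complex_dim (\<Delta> :: 'v::finite set set)"
  unfolding complex_dim_def by simp

lemma face_dim_le_complex_dim: "F \<in> \<Delta> \<Longrightarrow> face_dim F \<le> complex_dim (\<Delta> :: 'v::finite set set)"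
  unfolding complex_dim_def by simp

lemma ex_facet_of_complex_dim:
  fixes \<Delta> :: "'v::finite set set"
  assumes "\<Delta> \<noteq> {}"
  shows "\<exists>F\<in>facets \<Delta>. face_dim F = complex_dim \<Delta>"
proof -
  have "Max (face_dim ` \<Delta>) \<in> face_dim ` \<Delta>" using assms by (intro Max_in) auto
  then obtain F where F: "F \<in> \<Delta>" "face_dim F = Max (face_dim ` \<Delta>)" by auto
  \<comment> \<open>The default -1 inserted in \<open>complex_dim\<close> thus does not change the
    maximum.\<close>
  moreover have "-1 \<le> face_dim F" unfolding face_dim_def by simp
  ultimately have dim: "face_dim F = complex_dim \<Delta>"
    unfolding complex_dim_def using assms by (simp add: max_def)
  \<comment> \<open>A face of largest cardinality is maximal under inclusion.\<close>
  have "F = G" if "G \<in> \<Delta>" "F \<subseteq> G" for G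
    using face_dim_le_complex_dim[OF that(1)] dim that(2)
    unfolding face_dim_def by (simp add: card_seteq)
  with F(1) dim show ?thesis unfolding facets_def by auto
qed

lemma pure_complex_card_facet:
  fixes \<Delta> :: "'v::finite set set"
  assumes "pure_complex \<Delta>" "F \<in> facets \<Delta>"
  shows "int (card F) = complex_dim \<Delta> + 1"
proof -
  have "\<Delta> \<noteq> {}" using assms(2) unfolding facets_def by auto
  then obtain G where "G \<in> facets \<Delta>" "face_dim G = complex_dim \<Delta>" using ex_facet_of_complex_dim by blast
  then have "face_dim F = complex_dim \<Delta>" using assms unfolding pure_complex_def by metis
  then show ?thesis unfolding face_dim_def by simp
qed

text \<open>Both f-vectors have the length of the type, and the length of an f-vector determines the
  dimension.\<close>

lemma quasi_f_simplicial_complex_dim_eq: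
  fixes \<Delta> :: "'v::finite set set"
  assumes "quasi_f_simplicial_complex TYPE('k::field) \<Delta>"
  shows "complex_dim {F. \<not> (\<exists>G\<in>facets \<Delta>. G \<subseteq> F)} = complex_dim {F. \<exists>G\<in>facets \<Delta>. F \<subseteq> G}"
    (is "complex_dim ?N = complex_dim ?D")
proof -
  have "length (f_vector ?N) = length (f_vector ?D)"
    using assms
    unfolding quasi_f_simplicial_complex_def quasi_f_ideal_def quasi_f_ideal_of_type_def
      facet_complex_facet_ideal nonface_complex_facet_ideal
    by metis
  then have "nat (complex_dim ?N + 1) = nat (complex_dim ?D + 1)" unfolding f_vector_def by simp
  \<comment> \<open>Dimensions are at least -1, so \<open>nat\<close> truncates neither
    side.\<close>
  then show ?thesis using complex_dim_ge[of ?N] complex_dim_ge[of ?D] by linarith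
qed

section \<open>Connectedness through chains of facets\<close>

lemma connected_complexI:
  assumes "\<And>F F'. F \<in> facets \<Delta> \<Longrightarrow> F' \<in> facets \<Delta> \<Longrightarrow>
    (F, F') \<in> {(A, B). A \<in> facets \<Delta> \<and> B \<in> facets \<Delta> \<and> A \<inter> B \<noteq> {}}\<^sup>*"
  shows "connected_complex \<Delta>"
  unfolding connected_complex_def
proof (intro ballI)
  fix F F' assume F: "F \<in> facets \<Delta>" "F' \<in> facets \<Delta>"
  obtain r S where S: "S 0 = F" "S r = F'"
    "\<And>i. i < r \<Longrightarrow> S i \<in> facets \<Delta> \<and> S (Suc i) \<in> facets \<Delta> \<and> S i \<inter> S (Suc i) \<noteq> {}"
    using assms[OF F] by (auto simp: rtrancl_power relpow_fun_conv)
  \<comment> \<open>The relation yields facets for \<open>i < r\<close>; the last index relies on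
    \<open>S r = F'\<close>, which also covers \<open>r = 0\<close>.\<close>
  have "S i \<in> facets \<Delta>" if "i \<le> r" for i
    using that S F by (cases "i = r") auto
  with S show "\<exists>r S. S 0 = F \<and> S r = F' \<and> (\<forall>i\<le>r. S i \<in> facets \<Delta>) \<and>
      (\<forall>i<r. S i \<inter> S (Suc i) \<noteq> {})"
    by blast
qed

theorem theorem4p1:
  fixes \<Delta> :: "'v::finite set set" and d :: int
  assumes "simplicial_complex_on UNIV \<Delta>"
    and "pure_complex \<Delta>"
    and "complex_dim \<Delta> = d"
    and "d > 1"
    and "quasi_f_simplicial_complex TYPE('k::field) \<Delta>"
  shows "connected_complex \<Delta>"
proof (rule connected_complexI)
  let ?D = "{F. \<exists>G\<in>facets \<Delta>. F \<subseteq> G}"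
  let ?N = "{F. \<not> (\<exists>G\<in>facets \<Delta>. G \<subseteq> F)}"
  let ?R = "{(A, B). A \<in> facets \<Delta> \<and> B \<in> facets \<Delta> \<and> A \<inter> B \<noteq> {}}"
  have card_facet: "int (card F) = d + 1" if "F \<in> facets \<Delta>" for F
    using pure_complex_card_facet assms(2,3) that by blast
  have "face_dim F \<le> d" if "F \<in> ?D" for F
    using that card_facet unfolding face_dim_def by (force dest: card_mono[rotated])
  \<comment> \<open>The bound on \<open>d\<close> takes care of the default -1 inside the
    maximum.\<close>
  then have "complex_dim ?D \<le> d" unfolding complex_dim_def using assms(4) by auto
  then have "complex_dim ?N \<le> d" using quasi_f_simplicial_complex_dim_eq[OF assms(5)] by simp
  \<comment> \<open>A set with \<open>d + 2\<close> elements has dimension \<open>d + 1\<close>, too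
    large for a face of \<open>?N\<close>.\<close>
  then have contains_facet: "\<exists>G\<in>facets \<Delta>. G \<subseteq> S" if "int (card S) = d + 2" for S
    using that face_dim_le_complex_dim[of S ?N] unfolding face_dim_def by fastforce
  fix F F' assume F: "F \<in> facets \<Delta>" and F': "F' \<in> facets \<Delta>"
  show "(F, F') \<in> ?R\<^sup>*"
  proof (cases "F \<inter> F' = {}")
    case False
    then show ?thesis using F F' by auto
  next
    case True
    \<comment> \<open>The sizes 2 and \<open>d\<close> add up to \<open>d + 2\<close>, yet each is
      smaller than the facet size \<open>d + 1\<close>; for 2 this is \<open>d > 1\<close>.\<close>
    obtain T where T: "T \<subseteq> F" "card T = 2"
      using obtain_subset_with_card_n[of 2 F] card_facet[OF F] assms(4) by auto
    have "nat d \<le> card F'" using card_facet[OF F'] by linarith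
    then obtain U where U: "U \<subseteq> F'" "card U = nat d"
      by (rule obtain_subset_with_card_n) blast
    have "card (T \<union> U) = card T + card U" using True T U by (intro card_Un_disjoint) auto
    then have "int (card (T \<union> U)) = d + 2" using T U assms(4) by simp
    then obtain G where G: "G \<in> facets \<Delta>" "G \<subseteq> T \<union> U" using contains_facet by blast
    have "\<not> G \<subseteq> T" "\<not> G \<subseteq> U"
      using card_mono[of T G] card_mono[of U G] card_facet[OF G(1)] T(2) U(2) assms(4) by auto
    \<comment> \<open>A point of \<open>G\<close> outside \<open>T\<close> lies in \<open>U\<close>,
      hence in \<open>F'\<close>; a point outside \<open>U\<close> lies in \<open>T\<close>, hence
      in \<open>F\<close>.\<close>
    then have "F \<inter> G \<noteq> {}" "G \<inter> F' \<noteq> {}" using G(2) T(1) U(1) by blast+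
    then have "(F, G) \<in> ?R" "(G, F') \<in> ?R" using F F' G(1) by auto
    then show ?thesis by (meson r_into_rtrancl rtrancl.rtrancl_into_rtrancl)
  qed
qed

end
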